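(* Let $k\ge1$ and $n>k$ be integers. Then $\inf_{\mathbf G}\mathrm{innerLP}^{\mathsf{DP}/\mathsf{ExAnte}}_{k,n}(\mathbf G)$, the infimum being over all type distributions $\mathbf G$ for $n$ agents (with any finite number $m$ of types), is equal to $$\inf_{\substack{g_1,\dots,g_n\in[0,1]\\ \sum_{i=1}^n g_i\le k}}\ \ \max\Big\{\theta:\ \theta\cdot g_i\le\sum_{l=1}^k\min\{y^l_i,g_ix^l_i\}\ \ \forall i\in[n],\ \ (\mathbf x,\mathbf y)\in\mathcal P^k_n\Big\},$$ where the inner maximum is over real $\theta$ and $(\mathbf x,\mathbf y)$.
   Context: $[n]=\{1,\dots,n\}$. Type distributions $\mathbf G$ (for $n$ agents): a positive integer $m$ and numbers $G_{ij}$, $i\in[n]$, $j\in\{0,1,\dots,m\}$, with $0=G_{i0}\le G_{i1}\le\cdots\le G_{im}=1$ for every $i$. $\mathcal P^k_n$ is the set of pairs $(\mathbf x,\mathbf y)$ of real arrays $\mathbf x=(x^l_i)_{i\in[n],l\in[k]}$, $\mathbf y=(y^l_i)_{i\in[n],l\in[k]}$ such that $0\le y^l_i\le x^l_i$ for all $i,l$; $x^k_1=1$; $x^l_1=0$ for $l<k$; and $x^l_i=x^l_{i-1}-y^l_{i-1}+y^{l+1}_{i-1}$ for all $i>1$, $l\in[k]$, with the convention $y^{k+1}_{i}=0$. $\mathrm{innerLP}^{\mathsf{DP}/\mathsf{ExAnte}}_{k,n}(\mathbf G)$ is the optimal value of: maximize $\theta$ over real $\theta$ and $(\mathbf x,\mathbf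 y)\in\mathcal P^k_n$ subject to $\theta\cdot\min\{\sum_{i=1}^nG_{ij},k\}\le\sum_{i=1}^n\sum_{l=1}^k\min\{y^l_i,G_{ij}x^l_i\}$ for all $j\in[m]$. If the inner maximization is unbounded (all $g_i=0$), its value is $+\infty$. *)

theory Defs
  imports "HOL-Library.Extended_Real"
begin

text \<open>Arrays are functions of natural-number indices, the agent index first:
  \<open>x i l\<close> stands for $x_i^l$ and \<open>G i j\<close> for $G_{ij}$.  Only entries with agent
  index in \<open>{1..n}\<close>, level in \<open>{1..k}\<close> and type in \<open>{0..m}\<close> are constrained or used;
  all other values are irrelevant.\<close>

definition type_dist :: "nat \<Rightarrow> nat \<Rightarrow> (nat \<Rightarrow> nat \<Rightarrow> real) \<Rightarrow> bool" where
  "type_dist n m G \<longleftrightarrow> m \<ge> 1 \<and>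
     (\<forall>i\<in>{1..n}. G i 0 = 0 \<and> (\<forall>j<m. G i j \<le> G i (j + 1)) \<and> G i m = 1)"

definition dp_polytope ::
    "nat \<Rightarrow> nat \<Rightarrow> ((nat \<Rightarrow> nat \<Rightarrow> real) \<times> (nat \<Rightarrow> nat \<Rightarrow> real)) set" where
  "dp_polytope k n = {(x, y).
     (\<forall>i\<in>{1..n}. \<forall>l\<in>{1..k}. 0 \<le> y i l \<and> y i l \<le> x i l) \<and>
     x 1 k = 1 \<and> (\<forall>l\<in>{1..<k}. x 1 l = 0) \<and>
     (\<forall>i\<in>{2..n}. \<forall>l\<in>{1..k}.
        x i l = x (i - 1) l - y (i - 1) l + (if l = k then 0 else y (i - 1) (l + 1)))}"

text \<open>The values of the maximization problems are suprema in the extended reals, so that an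
  unbounded problem has value \<open>\<infinity>\<close>.  Both problems are always feasible.\<close>

definition inner_LP :: "nat \<Rightarrow> nat \<Rightarrow> nat \<Rightarrow> (nat \<Rightarrow> nat \<Rightarrow> real) \<Rightarrow> ereal" where
  "inner_LP k n m G = Sup {ereal \<theta> | \<theta> x y. (x, y) \<in> dp_polytope k n \<and>
     (\<forall>j\<in>{1..m}. \<theta> * min (\<Sum>i=1..n. G i j) (real k)
        \<le> (\<Sum>i=1..n. \<Sum>l=1..k. min (y i l) (G i j * x i l)))}"

definition agentwise_LP :: "nat \<Rightarrow> nat \<Rightarrow> (nat \<Rightarrow> real) \<Rightarrow> ereal" where
  "agentwise_LP k n g = Sup {ereal \<theta> | \<theta> x y. (x, y) \<in> dp_polytope k n \<and>
     (\<forall>i\<in>{1..n}. \<theta> * g i \<le> (\<Sum>l=1..k. min (y i l) (g i * x i l)))}"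

end

theory Submission imports Defs begin

text \<open>A feasible \<open>(x, y)\<close> is encoded by the tail sums \<open>A t l\<close>, the probability that at least \<open>l\<close>
  units remain before agent \<open>t\<close>; a policy that accepts only a fraction of the active agents is then
  a sequence with \<open>(1 - g\<^sub>t) A t l + g\<^sub>t A t (l+1) \<le> A (t+1) l \<le> A t l\<close>, a convex condition.

  Given \<open>g\<close> with sum at most \<open>k\<close>, let later agents have the higher types: type \<open>j \<le> n\<close> has
  \<open>G\<^sub>i\<^sub>j = g\<^sub>i\<close> exactly for the last \<open>j\<close> agents. Feasibility of \<open>\<theta>\<close> for \<open>G\<close> bounds the total
  service of every suffix of agents below by \<open>\<theta>\<close> times its demand. This can be upgraded to a bound
  for each agent: serving as early as possible subject to the same final distribution makes the
  service per unit of demand nonincreasing in time. If that policy satisfies all suffix bounds, then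
  it satisfies all individual ones; otherwise, move from the given policy towards it until the first
  suffix bound becomes tight, split the agents there, and recurse on both parts.

  Conversely, given \<open>G\<close>, interpolate between the two consecutive types at which \<open>\<Sum>\<^sub>i G\<^sub>i\<^sub>j\<close> crosses
  \<open>k\<close> to get \<open>g\<close> with sum \<open>k\<close>. An agentwise solution for \<open>g\<close> is feasible for each type \<open>j\<close>, by
  monotonicity of \<open>min y (p x)\<close> in \<open>p\<close> above the crossing and by its concavity below.\<close>

section \<open>Paths of stock tails and their closure properties\<close>

text \<open>With \<open>x = A t l - A t (Suc l)\<close> the probability of level \<open>l\<close>
  and \<open>y = A t l - A (Suc t) l\<close> the service from it, the two step inequalities read
  \<open>0 <= y\<close> and \<open>y <= g t * x\<close>. The order of the levels is imposed only at
  time \<open>i\<close>; it propagates when every \<open>g t\<close> lies in [0,1].\<close>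

definition stock_path :: "nat \<Rightarrow> (nat \<Rightarrow> real) \<Rightarrow> nat \<Rightarrow> nat \<Rightarrow> (nat \<Rightarrow> nat \<Rightarrow> real) \<Rightarrow> bool" where
  "stock_path k g i j A \<longleftrightarrow>
     (\<forall>t\<in>{i..j}. A t (Suc k) = 0) \<and>
     (\<forall>l\<in>{1..k}. A i (Suc l) \<le> A i l) \<and>
     (\<forall>t\<in>{i..<j}. \<forall>l\<in>{1..k}. A (Suc t) l \<le> A t l \<and>
        (1 - g t) * A t l + g t * A t (Suc l) \<le> A (Suc t) l)"

definition served :: "nat \<Rightarrow> (nat \<Rightarrow> nat \<Rightarrow> real) \<Rightarrow> nat \<Rightarrow> real" where
  "served k A t = (\<Sum>l=1..k. A t l - A (Suc t) l)"

text \<open>The lowest next tails that acceptance probability \<open>p\<close> allows above the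
  floor \<open>F\<close>. Copying \<open>F\<close> outside the levels lets a path reach
  \<open>A j\<close> as a whole function, which gluing relies on.\<close>

definition floor_step :: "nat \<Rightarrow> real \<Rightarrow> (nat \<Rightarrow> real) \<Rightarrow> (nat \<Rightarrow> real) \<Rightarrow> nat \<Rightarrow> real" where
  "floor_step k p F a l = (if l \<in> {1..k} then max (F l) ((1 - p) * a l + p * a (Suc l)) else F l)"

lemma convex_comb_mono:
  fixes p :: real
  assumes "0 \<le> p" "p \<le> 1" "a \<le> a'" "b \<le> b'"
  shows "(1 - p) * a + p * b \<le> (1 - p) * a' + p * b'"
  using assms by (intro add_mono mult_left_mono) auto

lemma convex_comb_bounds:
  fixes p :: real
  assumes "0 \<le> p" "p \<le> 1" "b \<le> a"
  shows "b \<le> (1 - p) * a + p * b" and "(1 - p) * a + p * b \<le> a"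
  using convex_comb_mono[OF assms(1,2), of b a b b] convex_comb_mono[OF assms(1,2), of a a b a] assms(3)
  by (simp_all add: algebra_simps)

text \<open>A convex combination of the tails at \<open>l\<close> and \<open>Suc l\<close> is at
  least the tail at \<open>Suc l\<close>, and that tail only falls with time.\<close>

lemma stock_path_level_mono:
  assumes g: "\<And>t. t \<in> {i..<j} \<Longrightarrow> 0 \<le> g t \<and> g t \<le> 1" and A: "stock_path k g i j A"
    and t: "i \<le> t" "t \<le> j" and l: "l \<in> {1..k}"
  shows "A t (Suc l) \<le> A t l"
  using t l
proof (induction t arbitrary: l rule: dec_induct)
  case base
  then show ?case using A by (simp add: stock_path_def)
next
  case (step t)
  have t: "t \<in> {i..<j}" using step by auto
  have "A t (Suc l) \<le> A t l" using step by auto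
  then have "A t (Suc l) \<le> (1 - g t) * A t l + g t * A t (Suc l)"
    using convex_comb_bounds(1) g[OF t] by blast
  also have "\<dots> \<le> A (Suc t) l" using A t step.prems by (simp add: stock_path_def)
  finally have "A t (Suc l) \<le> A (Suc t) l" .
  moreover have "A (Suc t) (Suc l) \<le> A t (Suc l)"
  proof (cases "l = k")
    case True
    then show ?thesis using A t by (simp add: stock_path_def)
  next
    case False
    then have "Suc l \<in> {1..k}" using step.prems by auto
    then show ?thesis using A t unfolding stock_path_def by blast
  qed
  ultimately show ?case by simp
qed

lemma stock_path_sub:
  assumes g: "\<And>t. t \<in> {i..<j} \<Longrightarrow> 0 \<le> g t \<and> g t \<le> 1" and A: "stock_path k g i j A"
    and "i \<le> i'" "i' \<le> j'" "j' \<le> j"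
  shows "stock_path k g i' j' A"
  using A assms(3-5) stock_path_level_mono[OF g A, of i'] unfolding stock_path_def by auto

lemma stock_path_glue:
  assumes A: "stock_path k g i m A" and B: "stock_path k g m j B"
    and "i \<le> m" "m \<le> j" and eq: "A m = B m"
  shows "stock_path k g i j (\<lambda>t. if t \<le> m then A t else B t)"
proof -
  let ?C = "\<lambda>t. if t \<le> m then A t else B t"
  have "?C (Suc t) l \<le> ?C t l \<and> (1 - g t) * ?C t l + g t * ?C t (Suc l) \<le> ?C (Suc t) l"
    if t: "t \<in> {i..<j}" and l: "l \<in> {1..k}" for t l
  proof (cases "Suc t \<le> m")
    case True
    then show ?thesis using A t l by (auto simp: stock_path_def)
  next
    case False
    then have "?C t = B t" using eq by (cases "t = m") auto
    then show ?thesis using B False t l by (auto simp: stock_path_def)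
  qed
  then show ?thesis using A B assms(3) by (auto simp: stock_path_def)
qed

lemma served_glue:
  assumes "A m = B m"
  shows "served k (\<lambda>t. if t \<le> m then A t else B t) t = (if t < m then served k A t else served k B t)"
  using assms by (cases "t = m") (auto simp: served_def)

lemma stock_path_mix:
  assumes A: "stock_path k g i j A" and B: "stock_path k g i j B" and c: "0 \<le> c" "c \<le> (1::real)"
  shows "stock_path k g i j (\<lambda>t l. (1 - c) * A t l + c * B t l)"
proof -
  have "(1 - p) * ((1 - c) * a + c * b) + p * ((1 - c) * a' + c * b') =
     (1 - c) * ((1 - p) * a + p * a') + c * ((1 - p) * b + p * b')" for a b a' b' p :: real
    by (simp add: algebra_simps)
  then show ?thesis using A B c unfolding stock_path_def by (auto intro!: convex_comb_mono)
qed

lemma served_mix: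
  "served k (\<lambda>t l. (1 - c) * A t l + c * B t l) t = (1 - c) * served k A t + c * served k B t"
  by (simp add: served_def sum_distrib_left sum.distrib[symmetric] sum_subtractf[symmetric] algebra_simps)

text \<open>Telescoping: the total service depends only on the tails at the two ends.\<close>

lemma sum_served:
  assumes "i \<le> j"
  shows "(\<Sum>t=i..<j. served k A t) = (\<Sum>l=1..k. A i l - A j l)"
  using assms by (induction j rule: dec_induct)
    (auto simp: served_def sum.distrib[symmetric] intro!: sum.cong)

section \<open>Greedy service above a floor\<close>

lemma recursive_path:
  fixes f :: "nat \<Rightarrow> 'a \<Rightarrow> 'a"
  obtains B where "B i = a" "\<And>t. i \<le> t \<Longrightarrow> B (Suc t) = f t (B t)"
proof -
  let ?B = "\<lambda>t. rec_nat a (\<lambda>d. f (i + d)) (t - i)"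
  show thesis by (rule that[of ?B]) (simp_all add: Suc_diff_le)
qed

text \<open>The maximum of two sequences that decrease in the level decreases too, and it stays
  below \<open>B t\<close> because the floor and the convex combination both do. A floor falling
  with time keeps the path above the next floor as well. This covers a fixed floor and a moving
  one.\<close>

lemma floor_step_path:
  assumes g: "\<And>t. t \<in> {i..<j} \<Longrightarrow> 0 \<le> g t \<and> g t \<le> 1"
    and F0: "\<And>t. t \<in> {i..<j} \<Longrightarrow> F t (Suc k) = 0"
    and Fl: "\<And>t l. t \<in> {i..<j} \<Longrightarrow> l \<in> {1..k} \<Longrightarrow> F t (Suc l) \<le> F t l"
    and Ft: "\<And>t l. t \<in> {i..<j} \<Longrightarrow> Suc t < j \<Longrightarrow> l \<in> {1..k} \<Longrightarrow> F (Suc t) l \<le> F t l"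
    and B0: "B i (Suc k) = 0" "\<And>l. l \<in> {1..k} \<Longrightarrow> B i (Suc l) \<le> B i l"
      "\<And>l. i < j \<Longrightarrow> l \<in> {1..k} \<Longrightarrow> F i l \<le> B i l"
    and B: "\<And>t. t \<in> {i..<j} \<Longrightarrow> B (Suc t) = floor_step k (g t) (F t) (B t)"
  shows "stock_path k g i j B"
proof -
  have inv: "B t (Suc k) = 0 \<and> (\<forall>l\<in>{1..k}. B t (Suc l) \<le> B t l) \<and>
      (t < j \<longrightarrow> (\<forall>l\<in>{1..k}. F t l \<le> B t l))" if "i \<le> t" "t \<le> j" for t
    using that
  proof (induction t rule: dec_induct)
    case base
    then show ?case using B0 by auto
  next
    case (step t)
    then have t: "t \<in> {i..<j}" by auto
    have IH: "B t (Suc k) = 0" "\<And>l. l \<in> {1..k} \<Longrightarrow> B t (Suc l) \<le> B t l" using step by auto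
    note Bt = B[OF t]
    have 0: "B (Suc t) (Suc k) = 0" using F0[OF t] by (simp add: Bt floor_step_def)
    have "B (Suc t) (Suc l) \<le> B (Suc t) l" if l: "l \<in> {1..k}" for l
    proof (cases "l = k")
      case True
      then show ?thesis using 0 l Fl[OF t l] F0[OF t] by (auto simp: Bt floor_step_def)
    next
      case False
      then have l': "Suc l \<in> {1..k}" using l by auto
      show ?thesis
        using l l' Fl[OF t l] convex_comb_mono[of "g t" "B t (Suc l)" "B t l" "B t (Suc (Suc l))" "B t (Suc l)"]
          g[OF t] IH(2)[OF l] IH(2)[OF l']
        by (auto simp: Bt floor_step_def)
    qed
    moreover have "F (Suc t) l \<le> B (Suc t) l" if "Suc t < j" "l \<in> {1..k}" for l
      using Ft[OF t that] that by (auto simp: Bt floor_step_def)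
    ultimately show ?case using 0 by auto
  qed
  have "B (Suc t) l \<le> B t l \<and> (1 - g t) * B t l + g t * B t (Suc l) \<le> B (Suc t) l"
    if t: "t \<in> {i..<j}" and l: "l \<in> {1..k}" for t l
    using inv[of t] t l convex_comb_bounds(2)[of "g t" "B t (Suc l)" "B t l"] g[OF t]
    by (auto simp: B[OF t] floor_step_def)
  then show ?thesis using inv B0 unfolding stock_path_def by auto
qed

lemma sum_shift_le:
  fixes f :: "nat \<Rightarrow> real"
  assumes "f (Suc k) \<le> 0" "k \<ge> 1 \<Longrightarrow> 0 \<le> f 1"
  shows "(\<Sum>l=1..k. f (Suc l)) \<le> (\<Sum>l=1..k. f l)"
proof (cases "k \<ge> 1")
  case True
  have "(\<Sum>l=1..k. f (Suc l)) - (\<Sum>l=1..k. f l) = f (Suc k) - f 1"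
    using True sum_Suc_diff[of 1 k f] by (simp add: sum_subtractf)
  then show ?thesis using assms True by auto
qed auto

text \<open>\<open>R t\<close> is the probability that, before agent \<open>t\<close>, the stock is at a level not yet drained to
  its final tail probability. The two bounds sandwich the service per unit of demand between
  consecutive values of \<open>R\<close> without dividing by \<open>g t\<close>, which may be \<open>0\<close>.\<close>

lemma early_path:
  assumes g: "\<And>t. t \<in> {i..<j} \<Longrightarrow> 0 \<le> g t \<and> g t \<le> 1" and A: "stock_path k g i j A" and ij: "i \<le> j"
  obtains B R where "stock_path k g i j B" "B i = A i" "B j = A j"
    "\<And>t. t \<in> {i..<j} \<Longrightarrow> served k B t \<le> g t * R t"
    "\<And>t. t \<in> {i..<j} \<Longrightarrow> g t * R (Suc t) \<le> served k B t"
    "\<And>t. t \<in> {i..<j} \<Longrightarrow> R (Suc t) \<le> R t"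
proof -
  define F where "F = A j"
  obtain B where Bi: "B i = A i" and B: "\<And>t. i \<le> t \<Longrightarrow> B (Suc t) = floor_step k (g t) F (B t)"
    using recursive_path[of i "A i" "\<lambda>t. floor_step k (g t) F"] by metis
  have F0: "F (Suc k) = 0" using A ij by (simp add: stock_path_def F_def)
  have Fl: "F (Suc l) \<le> F l" if "l \<in> {1..k}" for l
    using stock_path_level_mono[OF g A ij order_refl that] by (simp add: F_def)
  have FA: "F l \<le> A t l" if "t \<le> j" "i \<le> t" "l \<in> {1..k}" for t l
    using that
  proof (induction t rule: inc_induct)
    case base
    then show ?case by (simp add: F_def)
  next
    case (step t)
    then have "A (Suc t) l \<le> A t l" using A by (auto simp: stock_path_def)
    then show ?case using step by auto
  qed
  have pB: "stock_path k g i j B"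
    using A ij by (intro floor_step_path[where F = "\<lambda>_. F"] g)
      (auto simp: Bi B F0 Fl stock_path_def intro!: FA)
  have FB: "F l \<le> B t l" if "i \<le> t" "t \<le> j" "l \<in> {1..k}" for t l
    using that by (induction t rule: dec_induct) (auto simp: Bi B floor_step_def FA)
  \<comment> \<open>Greedy service gives the lowest path above the floor, so \<open>B\<close> lies
    below \<open>A\<close>. At time \<open>j\<close> the path \<open>A\<close> is the floor itself,
    which forces \<open>B j = A j\<close>.\<close>
  have BA: "B t l \<le> A t l" if "i \<le> t" "t \<le> j" "l \<in> {1..k}" for t l
    using that
  proof (induction t arbitrary: l rule: dec_induct)
    case base
    then show ?case by (simp add: Bi)
  next
    case (step t)
    then have t: "t \<in> {i..<j}" by auto
    have "B t (Suc l) \<le> A t (Suc l)"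
    proof (cases "l = k")
      case True
      then show ?thesis using A pB t by (auto simp: stock_path_def)
    next
      case False
      then show ?thesis using step by auto
    qed
    then have "(1 - g t) * B t l + g t * B t (Suc l) \<le> (1 - g t) * A t l + g t * A t (Suc l)"
      using step g[OF t] by (intro convex_comb_mono) auto
    also have "\<dots> \<le> A (Suc t) l" using A t step.prems by (auto simp: stock_path_def)
    finally show ?case using step.prems step.hyps FA[of "Suc t" l] by (auto simp: B floor_step_def)
  qed
  have Bj: "B j = A j"
  proof (cases "i = j")
    case False
    then obtain t where t: "j = Suc t" "i \<le> t" using ij by (cases j) auto
    show ?thesis
    proof
      fix l
      show "B j l = A j l"
      proof (cases "l \<in> {1..k}")
        case True
        then show ?thesis using BA[of j l] FB[of j l] ij by (auto simp: F_def)
      next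
        case False
        then have "B j l = F l" using t B by (auto simp: floor_step_def)
        then show ?thesis by (simp add: F_def)
      qed
    qed
  qed (use Bi in auto)
  define U where "U t = {l \<in> {1..k}. F l < B t l}" for t
  define R where "R t = (\<Sum>l\<in>U t. B t l - B t (Suc l))" for t
  have U: "finite (U t)" "U t \<subseteq> {1..k}" for t unfolding U_def by auto
  have dec: "0 \<le> B t l - B (Suc t) l" if "t \<in> {i..<j}" "l \<in> {1..k}" for t l
    using pB that by (auto simp: stock_path_def)
  \<comment> \<open>Levels already drained to the floor are not served; any other level loses at
    most the fraction \<open>g t\<close> of its mass.\<close>
  have up: "served k B t \<le> g t * R t" if t: "t \<in> {i..<j}" for t
  proof -
    have "served k B t = (\<Sum>l\<in>U t. B t l - B (Suc t) l)"
      unfolding served_def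
    proof (intro sum.mono_neutral_right ballI)
      fix l assume l: "l \<in> {1..k} - U t"
      then have "B t l = F l" using FB[of t l] t unfolding U_def by force
      then show "B t l - B (Suc t) l = 0" using dec[OF t, of l] FB[of "Suc t" l] t l by auto
    qed (use U in auto)
    also have "\<dots> \<le> (\<Sum>l\<in>U t. g t * (B t l - B t (Suc l)))"
    proof (intro sum_mono)
      fix l assume "l \<in> U t"
      then have "(1 - g t) * B t l + g t * B t (Suc l) \<le> B (Suc t) l"
        using pB t U unfolding stock_path_def by blast
      then show "B t l - B (Suc t) l \<le> g t * (B t l - B t (Suc l))" by (simp add: algebra_simps)
    qed
    finally show ?thesis by (simp add: R_def sum_distrib_left)
  qed
  \<comment> \<open>At a level still above the floor after the step, the maximum is attained by the
    convex combination. The mass there, times \<open>g t\<close>, is then a mixture of the services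
    from levels \<open>l\<close> and \<open>Suc l\<close>, and shifting the level cannot increase
    the total service.\<close>
  have low: "g t * R (Suc t) \<le> served k B t" if t: "t \<in> {i..<j}" for t
  proof -
    define y where "y l = B t l - B (Suc t) l" for l
    have y0: "y (Suc k) = 0" using pB t by (auto simp: stock_path_def y_def)
    have ynn: "0 \<le> y l" if "l \<in> {1..Suc k}" for l
      using dec[OF t, of l] y0 that by (cases "l = Suc k") (auto simp: y_def)
    have "g t * R (Suc t) = (\<Sum>l\<in>U (Suc t). (1 - g t) * y l + g t * y (Suc l))"
      unfolding R_def sum_distrib_left
    proof (intro sum.cong refl)
      fix l assume l: "l \<in> U (Suc t)"
      have "B (Suc t) l = (1 - g t) * B t l + g t * B t (Suc l)"
        using l t by (auto simp: U_def B floor_step_def)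
      then show "g t * (B (Suc t) l - B (Suc t) (Suc l)) = (1 - g t) * y l + g t * y (Suc l)"
        unfolding y_def by (simp add: algebra_simps)
    qed
    also have "\<dots> \<le> (\<Sum>l=1..k. (1 - g t) * y l + g t * y (Suc l))"
      using U(2)[of "Suc t"] g[OF t] by (intro sum_mono2) (auto intro!: add_nonneg_nonneg mult_nonneg_nonneg ynn)
    also have "\<dots> = (1 - g t) * (\<Sum>l=1..k. y l) + g t * (\<Sum>l=1..k. y (Suc l))"
      by (simp add: sum.distrib sum_distrib_left)
    also have "\<dots> \<le> (1 - g t) * (\<Sum>l=1..k. y l) + g t * (\<Sum>l=1..k. y l)"
      using g[OF t] y0 ynn by (intro convex_comb_mono sum_shift_le) auto
    finally show ?thesis by (simp add: served_def y_def algebra_simps)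
  qed
  have "R (Suc t) \<le> R t" if t: "t \<in> {i..<j}" for t
  proof (cases "g t = 0")
    \<comment> \<open>The sandwich says nothing about \<open>R\<close> here, but no stock moves, so
      \<open>R\<close> is unchanged.\<close>
    case True
    have "B (Suc t) l = B t l" if "l \<in> {1..Suc k}" for l
    proof (cases "l = Suc k")
      case True
      then show ?thesis using pB t by (auto simp: stock_path_def)
    next
      case False
      then show ?thesis using FB[of t l] t that \<open>g t = 0\<close> by (auto simp: B floor_step_def)
    qed
    then have "U (Suc t) = U t" "R (Suc t) = R t" unfolding R_def U_def by (auto intro!: sum.cong)
    then show ?thesis by simp
  next
    case False
    then show ?thesis using up[OF t] low[OF t] g[OF t] by (smt (verit) mult_le_cancel_left_pos)
  qed
  then show thesis using that pB Bi Bj up low by blast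
qed

section \<open>From suffix bounds to individual bounds\<close>

text \<open>Induction on the number of agents. Keeping both ends of the path fixed is what allows
  the solutions for the two parts to be glued.\<close>

lemma agentwise_service_if_suffix_service:
  fixes \<theta> :: real
  assumes "\<And>t. t \<in> {i..<j} \<Longrightarrow> 0 \<le> g t \<and> g t \<le> 1" "stock_path k g i j A" "i \<le> j"
    and "\<And>\<tau>. \<tau> \<in> {i..j} \<Longrightarrow> 0 \<le> (\<Sum>t=\<tau>..<j. served k A t - \<theta> * g t)"
  shows "\<exists>B. stock_path k g i j B \<and> B i = A i \<and> B j = A j \<and> (\<forall>t\<in>{i..<j}. \<theta> * g t \<le> served k B t)"
  using assms
proof (induction "j - i" arbitrary: i j A rule: less_induct)
  case less
  note g = less.prems(1) and A = less.prems(2) and ij = less.prems(3) and suf = less.prems(4)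
  obtain B R where B: "stock_path k g i j B" "B i = A i" "B j = A j"
    and R: "\<And>t. t \<in> {i..<j} \<Longrightarrow> served k B t \<le> g t * R t"
      "\<And>t. t \<in> {i..<j} \<Longrightarrow> g t * R (Suc t) \<le> served k B t"
      "\<And>t. t \<in> {i..<j} \<Longrightarrow> R (Suc t) \<le> R t"
    using early_path[OF g A ij] by metis
  define e where "e X \<tau> = (\<Sum>t=\<tau>..<j. served k X t - \<theta> * g t)" for X \<tau>
  have e0: "0 \<le> e A \<tau>" if "\<tau> \<in> {i..j}" for \<tau> using suf[OF that] by (simp add: e_def)
  show ?case
  proof (cases "\<forall>\<tau>\<in>{i..j}. 0 \<le> e B \<tau>")
    case True
    \<comment> \<open>An underserved agent \<open>t\<close> has \<open>R (Suc t) < \<theta>\<close>,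
      so all later agents get at most \<open>\<theta>\<close> per unit of demand, and the suffix
      from \<open>t\<close> has negative surplus.\<close>
    have "\<theta> * g t \<le> served k B t" if t: "t \<in> {i..<j}" for t
    proof (rule ccontr)
      assume neg: "\<not> \<theta> * g t \<le> served k B t"
      then have "g t * R (Suc t) < g t * \<theta>" using R(2)[OF t] by (simp add: mult.commute)
      then have Rt: "R (Suc t) < \<theta>" using g[OF t] by (metis mult_less_cancel_left_disj not_less)
      have Rle: "R t' \<le> R (Suc t)" if "Suc t \<le> t'" "t' \<le> j" for t'
        using that
      proof (induction t' rule: dec_induct)
        case (step s)
        then show ?case using R(3)[of s] t by auto
      qed simp
      have "e B (Suc t) \<le> 0"
        unfolding e_def
      proof (intro sum_nonpos)
        fix s assume s: "s \<in> {Suc t..<j}"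
        then have s': "s \<in> {i..<j}" using t by auto
        have "served k B s \<le> g s * R s" using R(1)[OF s'] .
        also have "\<dots> \<le> g s * \<theta>"
          using Rle[of s] Rt s g[OF s'] by (intro mult_left_mono) auto
        finally show "served k B s - \<theta> * g s \<le> 0" by (simp add: mult.commute)
      qed
      moreover have "e B t = (served k B t - \<theta> * g t) + e B (Suc t)"
        using t by (simp add: e_def sum.atLeast_Suc_lessThan)
      ultimately show False using True t neg by force
    qed
    then show ?thesis using B by blast
  next
    case False
    \<comment> \<open>For \<open>\<tau>\<close> in \<open>V\<close>, this is the fraction of the way
      from \<open>A\<close> to \<open>B\<close> at which the surplus of the suffix from
      \<open>\<tau>\<close> reaches 0. The least such fraction marks the first tight suffix.\<close>
    define c where "c \<tau> = e A \<tau> / (e A \<tau> - e B \<tau>)" for \<tau>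
    define V where "V = {\<tau> \<in> {i..j}. e B \<tau> < 0}"
    have "finite V" by (simp add: V_def)
    moreover have "V \<noteq> {}" using False unfolding V_def by force
    ultimately obtain \<tau> where \<tau>: "\<tau> \<in> V" and \<tau>_min: "\<And>\<sigma>. \<sigma> \<in> V \<Longrightarrow> c \<tau> \<le> c \<sigma>"
      using arg_min_if_finite(1)[of V c] arg_min_least[of V _ c] by blast
    have \<tau>V: "\<tau> \<in> {i..j}" "e B \<tau> < 0" "0 \<le> e A \<tau>" using \<tau> e0 by (auto simp: V_def)
    have c01: "0 \<le> c \<tau>" "c \<tau> \<le> 1" using \<tau>V by (auto simp: c_def)
    define C where "C = (\<lambda>t l. (1 - c \<tau>) * A t l + c \<tau> * B t l)"
    have C: "stock_path k g i j C" unfolding C_def by (intro stock_path_mix A B c01)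
    have C_ends: "C i = A i" "C j = A j" unfolding C_def by (auto simp: B algebra_simps)
    have eC: "e C \<sigma> = (1 - c \<tau>) * e A \<sigma> + c \<tau> * e B \<sigma>" for \<sigma>
      unfolding e_def C_def served_mix sum_distrib_left sum.distrib[symmetric]
      by (simp add: algebra_simps)
    have tight: "e C \<tau> = 0"
      unfolding eC c_def using \<tau>V by (simp add: field_simps)
    have eC_nonneg: "0 \<le> e C \<sigma>" if \<sigma>: "\<sigma> \<in> {i..j}" for \<sigma>
    proof (cases "\<sigma> \<in> V")
      case True
      then have "c \<tau> \<le> e A \<sigma> / (e A \<sigma> - e B \<sigma>)" "0 < e A \<sigma> - e B \<sigma>"
        using \<tau>_min[OF True] e0[OF \<sigma>] by (auto simp: c_def V_def)
      then have "c \<tau> * (e A \<sigma> - e B \<sigma>) \<le> e A \<sigma>" by (simp add: pos_le_divide_eq)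
      then show ?thesis unfolding eC by (simp add: algebra_simps)
    next
      case False
      then show ?thesis unfolding eC using c01 e0[OF \<sigma>] \<sigma> by (auto simp: V_def)
    qed
    \<comment> \<open>Equal ends give equal total service, so the split is not at \<open>i\<close>;
      the empty suffix excludes \<open>j\<close>. Hence both parts are strictly shorter.\<close>
    have "e B i = e A i"
      unfolding e_def sum_subtractf sum_served[OF ij] by (simp add: B)
    then have "\<tau> \<noteq> i" using \<tau>V e0[of i] by auto
    moreover have "\<tau> \<noteq> j" using \<tau>V by (auto simp: e_def)
    ultimately have \<tau>_in: "i < \<tau>" "\<tau> < j" using \<tau>V by auto
    have "\<exists>B. stock_path k g i \<tau> B \<and> B i = C i \<and> B \<tau> = C \<tau> \<and> (\<forall>t\<in>{i..<\<tau>}. \<theta> * g t \<le> served k B t)"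
    proof (intro less.hyps)
      show "stock_path k g i \<tau> C" using \<tau>_in by (intro stock_path_sub[OF g C]) auto
      \<comment> \<open>As the suffix from \<open>\<tau>\<close> has surplus 0, cutting it off
        leaves the surplus of the suffix from \<open>\<sigma>\<close> unchanged.\<close>
      fix \<sigma> assume \<sigma>: "\<sigma> \<in> {i..\<tau>}"
      then have "e C \<sigma> = (\<Sum>t=\<sigma>..<\<tau>. served k C t - \<theta> * g t) + e C \<tau>"
        unfolding e_def using \<tau>_in by (simp add: sum.atLeastLessThan_concat)
      then show "0 \<le> (\<Sum>t=\<sigma>..<\<tau>. served k C t - \<theta> * g t)"
        using tight eC_nonneg[of \<sigma>] \<sigma> \<tau>_in by auto
    qed (use \<tau>_in g in auto)
    then obtain D where D: "stock_path k g i \<tau> D" "D i = C i" "D \<tau> = C \<tau>"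
      "\<And>t. t \<in> {i..<\<tau>} \<Longrightarrow> \<theta> * g t \<le> served k D t" by blast
    have "\<exists>B. stock_path k g \<tau> j B \<and> B \<tau> = C \<tau> \<and> B j = C j \<and> (\<forall>t\<in>{\<tau>..<j}. \<theta> * g t \<le> served k B t)"
    proof (intro less.hyps)
      show "stock_path k g \<tau> j C" using \<tau>_in by (intro stock_path_sub[OF g C]) auto
      show "0 \<le> (\<Sum>t=\<sigma>..<j. served k C t - \<theta> * g t)" if "\<sigma> \<in> {\<tau>..j}" for \<sigma>
        using eC_nonneg[of \<sigma>] that \<tau>_in by (auto simp: e_def)
    qed (use \<tau>_in g in auto)
    then obtain E where E: "stock_path k g \<tau> j E" "E \<tau> = C \<tau>" "E j = C j"
      "\<And>t. t \<in> {\<tau>..<j} \<Longrightarrow> \<theta> * g t \<le> served k E t" by blast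
    have eq: "D \<tau> = E \<tau>" using D E by simp
    show ?thesis
      using stock_path_glue[OF D(1) E(1) _ _ eq] served_glue[of D \<tau> E k, OF eq] \<tau>_in D E C_ends
      by (intro exI[of _ "\<lambda>t. if t \<le> \<tau> then D t else E t"]) auto
  qed
qed

text \<open>Accepting with probability at most \<open>g t\<close> leaves more stock than the original policy, so
  later states change; that this does not reduce later services holds because the amount
  \<open>\<Sum>\<^sub>l min (a l - F l) (p (a l - a (l+1)))\<close> served from tails \<open>a\<close> is monotone in \<open>a\<close>.\<close>

lemma thin_path:
  assumes g: "\<And>t. t \<in> {i..<j} \<Longrightarrow> 0 \<le> g t \<and> g t \<le> 1"
    and A0: "\<And>t. t \<in> {i..j} \<Longrightarrow> A t (Suc k) = 0"
    and Al: "\<And>t l. t \<in> {i..j} \<Longrightarrow> l \<in> {1..k} \<Longrightarrow> A t (Suc l) \<le> A t l"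
    and At: "\<And>t l. t \<in> {i..<j} \<Longrightarrow> l \<in> {1..k} \<Longrightarrow> A (Suc t) l \<le> A t l"
    and ij: "i \<le> j"
  obtains B where "stock_path k g i j B" "B i = A i"
    "\<And>t. t \<in> {i..<j} \<Longrightarrow>
       (\<Sum>l=1..k. min (A t l - A (Suc t) l) (g t * (A t l - A t (Suc l)))) \<le> served k B t"
proof -
  \<comment> \<open>The moving floor \<open>A (Suc t)\<close> makes \<open>B\<close> follow
    \<open>A\<close> downwards as fast as \<open>g\<close> permits.\<close>
  obtain B where Bi: "B i = A i" and B: "\<And>t. i \<le> t \<Longrightarrow> B (Suc t) = floor_step k (g t) (A (Suc t)) (B t)"
    using recursive_path[of i "A i" "\<lambda>t. floor_step k (g t) (A (Suc t))"] by metis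
  have pB: "stock_path k g i j B"
    by (intro floor_step_path[where F = "\<lambda>t. A (Suc t)"] g) (use ij in \<open>auto simp: Bi B A0 Al At\<close>)
  have AB: "A t l \<le> B t l" if "i \<le> t" "t \<le> j" "l \<in> {1..Suc k}" for t l
  proof (cases "l = Suc k")
    case True
    then show ?thesis using that A0[of t] pB by (auto simp: stock_path_def)
  next
    case False
    have "l \<in> {1..k}" using that False by auto
    with that(1) show ?thesis by (induction t rule: dec_induct) (auto simp: Bi B floor_step_def)
  qed
  have "(\<Sum>l=1..k. min (A t l - A (Suc t) l) (g t * (A t l - A t (Suc l)))) \<le> served k B t"
    if t: "t \<in> {i..<j}" for t
  proof -
    define d where "d l = B t l - A t l" for l
    have d: "0 \<le> d l" if "l \<in> {1..Suc k}" for l using AB[of t l] that t by (auto simp: d_def)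
    have d0: "d (Suc k) = 0" using A0[of t] pB t by (auto simp: d_def stock_path_def)
    have "(\<Sum>l=1..k. min (A t l - A (Suc t) l) (g t * (A t l - A t (Suc l)))) - served k B t
       = (\<Sum>l=1..k. min (A t l - A (Suc t) l) (g t * (A t l - A t (Suc l))) - (B t l - B (Suc t) l))"
      by (simp add: served_def sum_subtractf)
    \<comment> \<open>If the floor binds, the left side is at most \<open>- d l\<close>, and
      \<open>d \<ge> 0\<close> suffices; otherwise compare with the second argument of
      \<open>min\<close>. The right side then sums to at most 0 by shifting the level.\<close>
    also have "\<dots> \<le> (\<Sum>l=1..k. g t * d (Suc l) - g t * d l)"
    proof (intro sum_mono)
      fix l assume l: "l \<in> {1..k}"
      have "0 \<le> (1 - g t) * d l" "0 \<le> g t * d (Suc l)" using d l g[OF t] by auto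
      then show "min (A t l - A (Suc t) l) (g t * (A t l - A t (Suc l))) - (B t l - B (Suc t) l)
          \<le> g t * d (Suc l) - g t * d l"
        using l t by (auto simp: B floor_step_def d_def algebra_simps min_def max_def)
    qed
    also have "\<dots> = g t * ((\<Sum>l=1..k. d (Suc l)) - (\<Sum>l=1..k. d l))"
      by (simp add: sum_subtractf sum_distrib_left right_diff_distrib)
    also have "\<dots> \<le> 0"
      using g[OF t] d d0 sum_shift_le[of d k] by (intro mult_nonneg_nonpos) auto
    finally show ?thesis by simp
  qed
  then show thesis using that pB Bi by blast
qed

section \<open>Translation between the polytope and stock paths\<close>

text \<open>Service from level \<open>l\<close> moves mass to level \<open>l - 1\<close>, so it
  lowers the tail at \<open>l\<close> and no other. All tails at levels 1 to \<open>k\<close> start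
  at 1; the value 0 at \<open>Suc k\<close> says that stock never exceeds \<open>k\<close>.\<close>

lemma dp_polytope_tail:
  assumes xy: "(x, y) \<in> dp_polytope k n"
  defines "A \<equiv> \<lambda>i l. if l \<in> {1..k} then 1 - (\<Sum>s=1..<i. y s l) else (0::real)"
  assumes i: "1 \<le> i" "i \<le> n" and l: "l \<in> {1..k}"
  shows "x i l = A i l - A i (Suc l)"
  using i l
proof (induction i arbitrary: l rule: dec_induct)
  case base
  then show ?case using xy by (cases "l = k") (auto simp: dp_polytope_def A_def)
next
  case (step i)
  have "x (Suc i) l = x i l - y i l + (if l = k then 0 else y i (l + 1))"
    using xy step by (force simp: dp_polytope_def)
  also have "x i l = A i l - A i (Suc l)" using step by auto
  finally show ?case using step.prems step.hyps by (auto simp: A_def)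
qed

text \<open>A stock path already satisfies \<open>y <= g * x\<close>, so each \<open>min\<close> is
  just the service.\<close>

lemma stock_path_dp_polytope:
  assumes g: "\<And>t. t \<in> {1..n} \<Longrightarrow> 0 \<le> g t \<and> g t \<le> 1" and "k \<ge> 1"
    and B: "stock_path k g 1 (Suc n) B" and B1: "\<And>l. l \<in> {1..k} \<Longrightarrow> B 1 l = 1"
  defines "x \<equiv> \<lambda>i l. B i l - B i (Suc l)" and "y \<equiv> \<lambda>i l. B i l - B (Suc i) l"
  shows "(x, y) \<in> dp_polytope k n" and "\<And>i. i \<in> {1..n} \<Longrightarrow> (\<Sum>l=1..k. min (y i l) (g i * x i l)) = served k B i"
proof -
  have B0: "B i (Suc k) = 0" if "i \<in> {1..Suc n}" for i using B that by (auto simp: stock_path_def)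
  have yg: "0 \<le> y i l \<and> y i l \<le> g i * x i l" if "i \<in> {1..n}" "l \<in> {1..k}" for i l
    using B that by (auto simp: stock_path_def x_def y_def algebra_simps)
  have x0: "0 \<le> x i l" if "i \<in> {1..n}" "l \<in> {1..k}" for i l
    using stock_path_level_mono[OF _ B, of i l] g that by (auto simp: x_def)
  have "y i l \<le> x i l" if "i \<in> {1..n}" "l \<in> {1..k}" for i l
    using yg[OF that] g[OF that(1)] mult_right_mono[of "g i" 1 "x i l"] x0[OF that] by auto
  moreover have "x 1 k = 1" using B1[of k] B0[of 1] \<open>k \<ge> 1\<close> by (simp add: x_def)
  moreover have "x 1 l = 0" if "l \<in> {1..<k}" for l using that B1[of l] B1[of "Suc l"] by (auto simp: x_def)
  moreover have "x i l = x (i - 1) l - y (i - 1) l + (if l = k then 0 else y (i - 1) (l + 1))"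
    if i: "i \<in> {2..n}" and l: "l \<in> {1..k}" for i l
  proof -
    obtain s where "i = Suc s" "s \<ge> 1" using i by (cases i) auto
    then show ?thesis using i l B0[of i] B0[of s] by (auto simp: x_def y_def)
  qed
  ultimately show "(x, y) \<in> dp_polytope k n" using yg by (auto simp: dp_polytope_def)
  show "(\<Sum>l=1..k. min (y i l) (g i * x i l)) = served k B i" if "i \<in> {1..n}" for i
    unfolding served_def using yg[OF that] by (intro sum.cong) (auto simp: y_def)
qed

lemma agentwise_feasible_if_suffix_feasible:
  assumes g: "\<And>t. t \<in> {1..n} \<Longrightarrow> 0 \<le> g t \<and> g t \<le> 1" and k: "k \<ge> 1"
    and xy: "(x, y) \<in> dp_polytope k n"
    and suf: "\<And>\<tau>. \<tau> \<in> {1..n} \<Longrightarrow> \<theta> * (\<Sum>i=\<tau>..n. g i) \<le> (\<Sum>i=\<tau>..n. \<Sum>l=1..k. min (y i l) (g i * x i l))"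
  obtains x' y' where "(x', y') \<in> dp_polytope k n"
    "\<And>i. i \<in> {1..n} \<Longrightarrow> \<theta> * g i \<le> (\<Sum>l=1..k. min (y' i l) (g i * x' i l))"
proof -
  define A where "A = (\<lambda>i l. if l \<in> {1..k} then 1 - (\<Sum>s=1..<i. y s l) else (0::real))"
  have Ax: "x i l = A i l - A i (Suc l)" if "i \<in> {1..n}" "l \<in> {1..k}" for i l
    using dp_polytope_tail[OF xy, of i l] that by (simp add: A_def)
  have Ay: "y i l = A i l - A (Suc i) l" if "i \<in> {1..n}" "l \<in> {1..k}" for i l
    using that by (simp add: A_def)
  have yx: "0 \<le> y i l" "y i l \<le> x i l" if "i \<in> {1..n}" "l \<in> {1..k}" for i l
    using xy that by (auto simp: dp_polytope_def)
  have g': "0 \<le> g t \<and> g t \<le> 1" if "t \<in> {1..<Suc n}" for t using g that by auto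
  have A0: "A t (Suc k) = 0" for t by (simp add: A_def)
  have At: "A (Suc t) l \<le> A t l" if "t \<in> {1..<Suc n}" "l \<in> {1..k}" for t l
    using Ay[of t l] yx(1)[of t l] that by auto
  have Al: "A t (Suc l) \<le> A t l" if t: "t \<in> {1..Suc n}" and l: "l \<in> {1..k}" for t l
  proof (cases "t \<le> n")
    case True
    then show ?thesis using Ax[of t l] yx[of t l] t l by auto
  next
    \<comment> \<open>There is no agent \<open>Suc n\<close> whose \<open>x\<close> could supply the
      order of levels; it comes from \<open>y <= x\<close> at agent \<open>n\<close>, or from the
      initial tails if \<open>n = 0\<close>.\<close>
    case False
    show ?thesis
    proof (cases "n = 0")
      case True
      then show ?thesis using False t l by (auto simp: A_def)
    next
      case n: False
      then have n: "n \<in> {1..n}" and t: "t = Suc n" using False t by auto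
      have "A (Suc n) (Suc l) \<le> A n (Suc l)"
      proof (cases "l = k")
        case True
        then show ?thesis by (simp add: A0)
      next
        case False
        then show ?thesis using At[of n "Suc l"] n l by auto
      qed
      moreover have "A n (Suc l) \<le> A (Suc n) l" using Ax[OF n l] Ay[OF n l] yx[OF n l] by auto
      ultimately show ?thesis using t by simp
    qed
  qed
  obtain B where B: "stock_path k g 1 (Suc n) B" "B 1 = A 1"
    and Bs: "\<And>t. t \<in> {1..<Suc n} \<Longrightarrow>
       (\<Sum>l=1..k. min (A t l - A (Suc t) l) (g t * (A t l - A t (Suc l)))) \<le> served k B t"
    using thin_path[of 1 "Suc n" g A k, OF g' A0 Al At] by auto
  have Bxy: "(\<Sum>l=1..k. min (y t l) (g t * x t l)) \<le> served k B t" if t: "t \<in> {1..n}" for t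
  proof -
    have "(\<Sum>l=1..k. min (y t l) (g t * x t l)) =
        (\<Sum>l=1..k. min (A t l - A (Suc t) l) (g t * (A t l - A t (Suc l))))"
      by (intro sum.cong refl) (simp add: Ax[OF t] Ay[OF t])
    then show ?thesis using Bs[of t] t by auto
  qed
  have "0 \<le> (\<Sum>t=\<tau>..<Suc n. served k B t - \<theta> * g t)" if \<tau>: "\<tau> \<in> {1..Suc n}" for \<tau>
  proof (cases "\<tau> = Suc n")
    case False
    then have \<tau>': "\<tau> \<in> {1..n}" using \<tau> by auto
    have "\<theta> * (\<Sum>i=\<tau>..n. g i) \<le> (\<Sum>i=\<tau>..n. served k B i)"
      using suf[OF \<tau>'] sum_mono[of "{\<tau>..n}" "\<lambda>i. \<Sum>l=1..k. min (y i l) (g i * x i l)" "served k B"]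
        Bxy \<tau>' by force
    then show ?thesis by (simp add: sum_subtractf sum_distrib_left atLeastLessThanSuc_atLeastAtMost)
  qed simp
  then obtain C where C: "stock_path k g 1 (Suc n) C" "C 1 = B 1"
    "\<And>t. t \<in> {1..<Suc n} \<Longrightarrow> \<theta> * g t \<le> served k C t"
    using agentwise_service_if_suffix_service[of 1 "Suc n" g k B \<theta>] B g' by auto
  have "C 1 l = 1" if "l \<in> {1..k}" for l using C B that by (simp add: A_def)
  note res = stock_path_dp_polytope[OF g k C(1) this]
  show thesis by (rule that[OF res(1)]) (use res(2) C(3) in auto)
qed

section \<open>Comparison of the two infima\<close>

lemma suffix_type_dist_inner_LP_le:
  assumes g: "\<And>t. t \<in> {1..n} \<Longrightarrow> 0 \<le> g t \<and> g t \<le> 1" and sum: "(\<Sum>i=1..n. g i) \<le> real k" and k: "k \<ge> 1"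
  defines "G \<equiv> \<lambda>i j. if j = Suc n then 1 else if n < i + j then g i else 0"
  shows "type_dist n (Suc n) G" and "inner_LP k n (Suc n) G \<le> agentwise_LP k n g"
proof -
  show "type_dist n (Suc n) G" using g by (auto simp: type_dist_def G_def)
  show "inner_LP k n (Suc n) G \<le> agentwise_LP k n g"
    unfolding inner_LP_def agentwise_LP_def
  proof (intro Sup_subset_mono subsetI)
    fix v assume "v \<in> {ereal \<theta> | \<theta> x y. (x, y) \<in> dp_polytope k n \<and>
     (\<forall>j\<in>{1..Suc n}. \<theta> * min (\<Sum>i=1..n. G i j) (real k)
        \<le> (\<Sum>i=1..n. \<Sum>l=1..k. min (y i l) (G i j * x i l)))}"
    then obtain \<theta> x y where v: "v = ereal \<theta>" and xy: "(x, y) \<in> dp_polytope k n"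
      and feas: "\<And>j. j \<in> {1..Suc n} \<Longrightarrow> \<theta> * min (\<Sum>i=1..n. G i j) (real k)
        \<le> (\<Sum>i=1..n. \<Sum>l=1..k. min (y i l) (G i j * x i l))" by blast
    have suf: "\<theta> * (\<Sum>i=\<tau>..n. g i) \<le> (\<Sum>i=\<tau>..n. \<Sum>l=1..k. min (y i l) (g i * x i l))"
      if \<tau>: "\<tau> \<in> {1..n}" for \<tau>
    proof -
      \<comment> \<open>With this \<open>j\<close>, the condition \<open>n < i + j\<close> becomes
        \<open>\<tau> \<le> i\<close>.\<close>
      define j where "j = Suc n - \<tau>"
      have j: "j \<in> {1..Suc n}" using \<tau> by (auto simp: j_def)
      have G: "G i j = (if \<tau> \<le> i then g i else 0)" for i using \<tau> by (auto simp: G_def j_def)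
      have restrict: "(\<Sum>i=1..n. if \<tau> \<le> i then f i else 0) = (\<Sum>i=\<tau>..n. f i)" for f :: "nat \<Rightarrow> real"
        using \<tau> by (intro sum.mono_neutral_cong_right) auto
      have "(\<Sum>i=\<tau>..n. g i) \<le> (\<Sum>i=1..n. g i)" using \<tau> g by (intro sum_mono2) auto
      then have "min (\<Sum>i=1..n. G i j) (real k) = (\<Sum>i=\<tau>..n. g i)"
        using sum unfolding G restrict by simp
      \<comment> \<open>Agents before \<open>\<tau>\<close> contribute \<open>min y 0\<close>, which
        is 0 because \<open>y\<close> is nonnegative.\<close>
      moreover have "(\<Sum>i=1..n. \<Sum>l=1..k. min (y i l) (G i j * x i l)) =
          (\<Sum>i=1..n. if \<tau> \<le> i then \<Sum>l=1..k. min (y i l) (g i * x i l) else 0)"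
        using xy by (intro sum.cong refl) (auto simp: G dp_polytope_def)
      ultimately show ?thesis using feas[OF j] by (simp only: restrict)
    qed
    obtain x' y' where "(x', y') \<in> dp_polytope k n"
      "\<And>i. i \<in> {1..n} \<Longrightarrow> \<theta> * g i \<le> (\<Sum>l=1..k. min (y' i l) (g i * x' i l))"
      by (rule agentwise_feasible_if_suffix_feasible[OF g k xy suf]) blast+
    then show "v \<in> {ereal \<theta> | \<theta> x y. (x, y) \<in> dp_polytope k n \<and>
     (\<forall>i\<in>{1..n}. \<theta> * g i \<le> (\<Sum>l=1..k. min (y i l) (g i * x i l)))}"
      using v by blast
  qed
qed

lemma type_dist_mono:
  assumes "type_dist n m G" "i \<in> {1..n}" "j \<le> j'" "j' \<le> m"
  shows "G i j \<le> G i j'"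
  using assms(3,4)
proof (induction j' rule: dec_induct)
  case (step s)
  then have "G i s \<le> G i (s + 1)" using assms(1,2) by (auto simp: type_dist_def)
  then show ?case using step by auto
qed simp

lemma interpolated_agentwise_LP_le:
  assumes G: "type_dist n m G" and kn: "k < n"
  obtains g where "\<And>i. i \<in> {1..n} \<Longrightarrow> g i \<in> {0..1}" "(\<Sum>i=1..n. g i) = real k"
    "agentwise_LP k n g \<le> inner_LP k n m G"
proof -
  define S where "S j = (\<Sum>i=1..n. G i j)" for j
  have S: "S j \<le> S j'" if "j \<le> j'" "j' \<le> m" for j j'
    unfolding S_def by (intro sum_mono type_dist_mono[OF G _ that])
  have S0: "S 0 = 0" and Sm: "S m = n" using G by (auto simp: S_def type_dist_def)
  \<comment> \<open>The last type with total demand at most \<open>k\<close>. It exists since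
    \<open>S 0 = 0\<close>, and it lies below \<open>m\<close> since
    \<open>S m = n > k\<close>.\<close>
  define p where "p = (GREATEST j. j \<le> m \<and> S j \<le> k)"
  have p: "p \<le> m" "S p \<le> k"
    using GreatestI_nat[of "\<lambda>j. j \<le> m \<and> S j \<le> k" 0 m] S0 by (auto simp: p_def)
  have pm: "p < m" using p Sm kn by (cases "p = m") auto
  have pk: "k < S (Suc p)"
  proof (rule ccontr)
    assume "\<not> ?thesis"
    then have "Suc p \<le> p"
      unfolding p_def using pm by (intro Greatest_le_nat[of _ _ m]) (auto simp: p_def)
    then show False by simp
  qed
  \<comment> \<open>The weight for which the interpolated demands sum to exactly
    \<open>k\<close>.\<close>
  define c where "c = (k - S p) / (S (Suc p) - S p)"
  have c: "0 \<le> c" "c \<le> 1" using p pk by (auto simp: c_def)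
  define g where "g i = (1 - c) * G i p + c * G i (Suc p)" for i
  have lo: "G i j \<le> g i" if "i \<in> {1..n}" "j \<le> p" for i j
    using convex_comb_mono[OF c, of "G i j" "G i p" "G i j" "G i (Suc p)"] pm
      type_dist_mono[OF G that(1), of j p] type_dist_mono[OF G that(1), of j "Suc p"] that
    by (auto simp: g_def algebra_simps)
  have hi: "g i \<le> G i j" if "i \<in> {1..n}" "p < j" "j \<le> m" for i j
    using convex_comb_mono[OF c, of "G i p" "G i j" "G i (Suc p)" "G i j"]
      type_dist_mono[OF G that(1), of p j] type_dist_mono[OF G that(1), of "Suc p" j] that
    by (auto simp: g_def algebra_simps)
  have g01: "g i \<in> {0..1}" if i: "i \<in> {1..n}" for i
    using lo[OF i, of 0] hi[OF i pm] G i by (auto simp: type_dist_def)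
  have "(\<Sum>i=1..n. g i) = (1 - c) * S p + c * S (Suc p)"
    by (simp add: g_def S_def sum.distrib sum_distrib_left)
  also have "\<dots> = S p + c * (S (Suc p) - S p)" by (simp add: algebra_simps)
  also have "\<dots> = k" using p pk by (simp add: c_def)
  finally have sum: "(\<Sum>i=1..n. g i) = real k" .
  have "agentwise_LP k n g \<le> inner_LP k n m G"
    unfolding inner_LP_def agentwise_LP_def
  proof (intro Sup_subset_mono subsetI)
    fix v assume "v \<in> {ereal \<theta> | \<theta> x y. (x, y) \<in> dp_polytope k n \<and>
     (\<forall>i\<in>{1..n}. \<theta> * g i \<le> (\<Sum>l=1..k. min (y i l) (g i * x i l)))}"
    then obtain \<theta> x y where v: "v = ereal \<theta>" and xy: "(x, y) \<in> dp_polytope k n"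
      and feas: "\<And>i. i \<in> {1..n} \<Longrightarrow> \<theta> * g i \<le> (\<Sum>l=1..k. min (y i l) (g i * x i l))" by blast
    have yx: "0 \<le> y i l" "0 \<le> x i l" if "i \<in> {1..n}" "l \<in> {1..k}" for i l
      using xy that by (force simp: dp_polytope_def)+
    have "\<theta> * min (\<Sum>i=1..n. G i j) (real k) \<le> (\<Sum>i=1..n. \<Sum>l=1..k. min (y i l) (G i j * x i l))"
      if j: "j \<in> {1..m}" for j
    proof (cases "j \<le> p")
      case True
      have "S j \<le> k" using S[OF True p(1)] p(2) by simp
      then have "\<theta> * min (\<Sum>i=1..n. G i j) (real k) = (\<Sum>i=1..n. \<theta> * G i j)"
        by (simp add: S_def sum_distrib_left)
      also have "\<dots> \<le> (\<Sum>i=1..n. \<Sum>l=1..k. min (y i l) (G i j * x i l))"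
      proof (intro sum_mono)
        fix i assume i: "i \<in> {1..n}"
        have G0: "0 \<le> G i j" using type_dist_mono[OF G i, of 0 j] G i j by (auto simp: type_dist_def)
        show "\<theta> * G i j \<le> (\<Sum>l=1..k. min (y i l) (G i j * x i l))"
        proof (cases "G i j = 0")
          case True
          then show ?thesis using yx[OF i] by (auto intro!: sum_nonneg)
        next
          case False
          \<comment> \<open>Concavity in scaled form:
            \<open>r * min y (g * x) <= min y (r * g * x)\<close> for \<open>r\<close> in [0,1] and
            \<open>y \<ge> 0\<close>. Treating \<open>G i j = 0\<close> separately ensures
            \<open>g i > 0\<close> here.\<close>
          define r where "r = G i j / g i"
          have gpos: "0 < g i" using lo[OF i \<open>j \<le> p\<close>] G0 False by linarith
          have r: "0 \<le> r" "r \<le> 1" "r * g i = G i j"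
            using lo[OF i \<open>j \<le> p\<close>] G0 gpos by (auto simp: r_def)
          have "\<theta> * G i j = r * (\<theta> * g i)" by (simp add: r(3)[symmetric])
          also have "\<dots> \<le> r * (\<Sum>l=1..k. min (y i l) (g i * x i l))"
            using r(1) feas[OF i] by (rule mult_left_mono[rotated])
          also have "\<dots> = (\<Sum>l=1..k. min (r * y i l) (G i j * x i l))"
            using r by (simp add: sum_distrib_left min_mult_distrib_left mult.assoc[symmetric])
          also have "\<dots> \<le> (\<Sum>l=1..k. min (y i l) (G i j * x i l))"
            using yx(1)[OF i] r by (intro sum_mono min.mono order_refl mult_left_le_one_le) auto
          finally show ?thesis .
        qed
      qed
      finally show ?thesis .
    next
      \<comment> \<open>Above the crossing the demand is capped at \<open>k\<close>, the sum of the
        \<open>g i\<close>, while \<open>g i \<le> G i j\<close> can only enlarge the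
        service.\<close>
      case False
      then have pj: "p < j" "j \<le> m" using j by auto
      have "real k \<le> S j" using S[of "Suc p" j] pj pk by simp
      then have "\<theta> * min (\<Sum>i=1..n. G i j) (real k) = (\<Sum>i=1..n. \<theta> * g i)"
        using sum by (simp add: S_def sum_distrib_left[symmetric])
      also have "\<dots> \<le> (\<Sum>i=1..n. \<Sum>l=1..k. min (y i l) (g i * x i l))"
        by (intro sum_mono feas)
      also have "\<dots> \<le> (\<Sum>i=1..n. \<Sum>l=1..k. min (y i l) (G i j * x i l))"
        by (intro sum_mono min.mono order_refl mult_right_mono hi pj yx)
      finally show ?thesis .
    qed
    then show "v \<in> {ereal \<theta> | \<theta> x y. (x, y) \<in> dp_polytope k n \<and>
     (\<forall>j\<in>{1..m}. \<theta> * min (\<Sum>i=1..n. G i j) (real k)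
        \<le> (\<Sum>i=1..n. \<Sum>l=1..k. min (y i l) (G i j * x i l)))}"
      using v xy by blast
  qed
  then show thesis using that g01 sum by blast
qed

theorem theorem4:
  fixes k n :: nat
  assumes "k \<ge> 1" and "n > k"
  shows "Inf {inner_LP k n m G | m G. type_dist n m G}
       = Inf {agentwise_LP k n g | g :: nat \<Rightarrow> real.
           (\<forall>i\<in>{1..n}. g i \<in> {0..1}) \<and> (\<Sum>i=1..n. g i) \<le> real k}"
proof (intro antisym Inf_mono)
  fix v assume "v \<in> {agentwise_LP k n g | g :: nat \<Rightarrow> real.
      (\<forall>i\<in>{1..n}. g i \<in> {0..1}) \<and> (\<Sum>i=1..n. g i) \<le> real k}"
  then obtain g where "v = agentwise_LP k n g" "\<forall>i\<in>{1..n}. g i \<in> {0..1}"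
    "(\<Sum>i=1..n. g i) \<le> real k" by blast
  then show "\<exists>u\<in>{inner_LP k n m G | m G. type_dist n m G}. u \<le> v"
    using suffix_type_dist_inner_LP_le[of n g k] assms(1) by fastforce
next
  fix u assume "u \<in> {inner_LP k n m G | m G. type_dist n m G}"
  then obtain m G where "u = inner_LP k n m G" "type_dist n m G" by blast
  then show "\<exists>v\<in>{agentwise_LP k n g | g :: nat \<Rightarrow> real.
      (\<forall>i\<in>{1..n}. g i \<in> {0..1}) \<and> (\<Sum>i=1..n. g i) \<le> real k}. v \<le> u"
    using interpolated_agentwise_LP_le[of n m G k] assms(2)
    by (smt (verit, best) mem_Collect_eq order_refl)
qed

end
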